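(* Let $\alpha\in(1,2)$. Then the function $v(t)=\mathbb{P}(G_t)$, $t\ge0$, where $G_t=[\,|V(t)|<\infty\,]$ is the event that the set $V(t)$ of $t$-leaves of the $\alpha$-Riccati cascade is finite, is a solution of the $\alpha$-Riccati equation $$u'(t)+u(t)=u^2(\alpha t),\quad t>0,\qquad u(0)=u_0,$$ with initial data $u_0=1$, and it is distinct from both $\underline{u}(t)=\mathbb{P}(S>t)$ and $\bar{u}(t)\equiv1$, with $$\underline{u}(t)<v(t)<\bar{u}(t)\quad\text{for all } t>0.$$
   Context: Let $\mathcal{I}=\{\emptyset\}\cup\bigcup_{n\in\mathbb{N}}\{1,2\}^n$ (with $\mathbb{N}=\{1,2,\dots\}$) be the vertex set of the infinite rooted binary tree with root $\emptyset$. For $v\in\{1,2\}^n$ write $|v|=n$ (and $|\emptyset|=0$), and for $0\le j\le |v|$ let $v|j$ denote the truncation of $v$ to its first $j$ coordinates, with $v|0=\emptyset$. Let $\{T_v\}_{v\in\mathcal{I}}$ be i.i.d. exponential random variables with mean one. The family $\{\alpha^{-|v|}T_v\}_{v\in\mathcal{I}}$ is called the $\alpha$-Riccati cascade. The set of $t$-leaves is $$V(t)=\Big\{v\in\mathcal{I}:\ \sum_{j=0}^{|v|-1}\alpha^{-j}T_{v|j}\le t<\sum_{j=0}^{|v|}\alpha^{-j}T_{v|j}\Big\},\ t>0,\qquad V(0)=\{\emptyset\},$$ where an empty sum equals $0$. The shortest path of the cascade is $$S=\lim_{n\to\infty}\min_{|v|=n}\sum_{j=0}^{n}\alpha^{-j}T_{v|j}\in(0,\infty].$$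 *)

theory Defs
  imports "HOL-Probability.Probability"
begin

text \<open>
  Vertices of the infinite rooted binary tree are finite words over a two-letter alphabet,
  here \<^typ>\<open>bool list\<close> (the two letters, 1 and 2, are the two Booleans). The root is
  \<^term>\<open>[]\<close>, the height \<open>|v|\<close> is \<^term>\<open>length v\<close> and the truncation \<open>v|j\<close> is
  \<^term>\<open>take j v\<close>.
\<close>

type_synonym vertex = "bool list"

text \<open>The density \<^term>\<open>exponential_density 1\<close> has rate 1, hence mean 1.\<close>

definition iid_exponential_family :: "'a measure \<Rightarrow> (vertex \<Rightarrow> 'a \<Rightarrow> real) \<Rightarrow> bool" where
  "iid_exponential_family M T \<longleftrightarrow>
     prob_space.indep_vars M (\<lambda>_. borel) T UNIV \<and>
     (\<forall>v. distributed M lborel (T v) (exponential_density 1))"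

definition t_leaves :: "real \<Rightarrow> (vertex \<Rightarrow> 'a \<Rightarrow> real) \<Rightarrow> real \<Rightarrow> 'a \<Rightarrow> vertex set" where
  "t_leaves \<alpha> T t \<omega> =
     (if t = 0 then {[]}
      else {v. (\<Sum>j<length v. T (take j v) \<omega> / \<alpha> ^ j) \<le> t \<and>
               t < (\<Sum>j\<le>length v. T (take j v) \<omega> / \<alpha> ^ j)})"

text \<open>
  The limit is taken in the extended reals. The minima are nondecreasing in \<open>n\<close> wherever all
  \<open>T v\<close> are nonnegative, so the limit exists almost surely.
\<close>

definition shortest_path :: "real \<Rightarrow> (vertex \<Rightarrow> 'a \<Rightarrow> real) \<Rightarrow> 'a \<Rightarrow> ereal" where
  "shortest_path \<alpha> T \<omega> =
     lim (\<lambda>n. ereal (MIN v\<in>{v. length v = n}. \<Sum>j\<le>n. T (take j v) \<omega> / \<alpha> ^ j))"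

definition prob_finite_leaves :: "'a measure \<Rightarrow> real \<Rightarrow> (vertex \<Rightarrow> 'a \<Rightarrow> real) \<Rightarrow> real \<Rightarrow> real" where
  "prob_finite_leaves M \<alpha> T t = measure M {\<omega> \<in> space M. finite (t_leaves \<alpha> T t \<omega>)}"

definition prob_shortest_path_gt :: "'a measure \<Rightarrow> real \<Rightarrow> (vertex \<Rightarrow> 'a \<Rightarrow> real) \<Rightarrow> real \<Rightarrow> real" where
  "prob_shortest_path_gt M \<alpha> T t = measure M {\<omega> \<in> space M. shortest_path \<alpha> T \<omega> > ereal t}"

text \<open>
  Classical solutions on the half-line. Continuity on \<^term>\<open>{0..}\<close> is what ties the initial
  value to the equation, which is only required for positive times.
\<close>

definition riccati_solution :: "real \<Rightarrow> real \<Rightarrow> (real \<Rightarrow> real) \<Rightarrow> bool" where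
  "riccati_solution \<alpha> u\<^sub>0 u \<longleftrightarrow>
     continuous_on {0..} u \<and> u 0 = u\<^sub>0 \<and>
     (\<forall>t>0. u differentiable (at t) \<and> deriv u t + u t = (u (\<alpha> * t))\<^sup>2)"

end

theory Submission
  imports Defs
begin

text \<open>
  The proof follows the whole family of functions \<open>u\<^sub>r(t) = E r ^ |V(t)|\<close> for \<open>0 \<le> r \<le> 1\<close>,
  where infinite \<open>V(t)\<close> contribute \<open>0\<close>. Its end points are the probabilities that \<open>V(t)\<close> is
  finite (\<open>r = 1\<close>) and that \<open>V(t)\<close> is empty (\<open>r = 0\<close>). Splitting the tree at the root shows that
  every \<open>u\<^sub>r\<close> solves the Riccati equation with initial value \<open>r\<close>
  (\<open>distr_graft\<close>, \<open>leaf_gf_first_step\<close>, \<open>leaf_gf_integral_equation\<close>,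
  \<open>leaf_gf_has_real_derivative\<close>); for \<open>r = 1\<close> this is the equation for \<open>v\<close>.

  The gap between \<open>P(S > t)\<close> and \<open>v(t)\<close>: the longest path is finite because \<open>\<alpha> > 1\<close>, so with
  positive probability the whole tree has been traversed by a late time \<open>t\<close>, and \<open>V(t)\<close> is empty,
  hence finite, although \<open>S \<le> t\<close> (\<open>leaf_gf_0_near_1\<close>). The equation carries the positivity of
  \<open>u\<^sub>0\<close> back to every \<open>t > 0\<close> (\<open>vanishing_spreads\<close>, \<open>leaf_gf_0_pos\<close>).

  The gap between \<open>v(t)\<close> and \<open>1\<close>: if \<open>v(t) = 1\<close> for a single \<open>t > 0\<close>, then \<open>v\<close> is identically \<open>1\<close>,
  again by \<open>vanishing_spreads\<close>. To exclude this, consider \<open>d = 1 - u\<^sub>r\<close> for \<open>r < 1\<close>. It vanishes at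
  infinity, and integrating the equation over the half-line gives
  \<open>(2 - \<alpha>) \<integral> d + \<alpha> (1 - r) = \<integral> d\<^sup>2\<close>, which forces \<open>d\<close> to exceed \<open>2 - \<alpha>\<close> somewhere, uniformly
  in \<open>r\<close> (\<open>leaf_gf_deficit_large\<close>). A compactness argument lets \<open>r\<close> tend to \<open>1\<close>
  (\<open>leaf_gf_1_less_somewhere\<close>).
\<close>

section \<open>Leaves of a deterministic cascade\<close>

text \<open>
  A realisation of the cascade is a function \<open>x\<close> from the vertices to the reals. With
  \<open>n = length v\<close> and \<open>n = length v + 1\<close> the sum below is the time at which the branching process
  with lifetimes \<open>x v / \<alpha> ^ length v\<close> enters and leaves \<open>v\<close>. Keeping the number of summands
  separate from the vertex lets the same function serve all truncations of \<open>v\<close>.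
\<close>

definition path_sum :: "real \<Rightarrow> (vertex \<Rightarrow> real) \<Rightarrow> vertex \<Rightarrow> nat \<Rightarrow> real" where
  "path_sum \<alpha> x v n = (\<Sum>j<n. x (take j v) / \<alpha> ^ j)"

text \<open>
  This agrees with the set \<open>V(t)\<close> except possibly at \<open>t = 0\<close>. Without a special case there, the
  first-step decomposition holds for all nonnegative times, in particular when the root dies exactly
  at time \<open>t\<close>.
\<close>

definition leaves :: "real \<Rightarrow> (vertex \<Rightarrow> real) \<Rightarrow> real \<Rightarrow> vertex set" where
  "leaves \<alpha> x t = {v. path_sum \<alpha> x v (length v) \<le> t \<and> t < path_sum \<alpha> x v (Suc (length v))}"

lemma path_sum_Cons:
  "path_sum \<alpha> x (b # w) (Suc n) = x [] + path_sum \<alpha> (\<lambda>u. x (b # u)) w n / \<alpha>"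
proof -
  have "path_sum \<alpha> x (b # w) (Suc n) = x [] + (\<Sum>j<n. x (b # take j w) / \<alpha> ^ Suc j)"
    unfolding path_sum_def by (subst sum.lessThan_Suc_shift) simp
  also have "(\<Sum>j<n. x (b # take j w) / \<alpha> ^ Suc j) = path_sum \<alpha> (\<lambda>u. x (b # u)) w n / \<alpha>"
    unfolding path_sum_def sum_divide_distrib by (intro sum.cong) (auto simp: field_simps)
  finally show ?thesis .
qed

lemma path_sum_nonneg: "0 < \<alpha> \<Longrightarrow> (\<And>u. 0 \<le> x u) \<Longrightarrow> 0 \<le> path_sum \<alpha> x v n"
  unfolding path_sum_def by (intro sum_nonneg) simp

lemma path_sum_mono: "0 < \<alpha> \<Longrightarrow> (\<And>u. 0 \<le> x u) \<Longrightarrow> m \<le> n \<Longrightarrow> path_sum \<alpha> x v m \<le> path_sum \<alpha> x v n"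
  unfolding path_sum_def by (intro sum_mono2) auto

lemma path_sum_take: "n \<le> Suc m \<Longrightarrow> path_sum \<alpha> x (take m v) n = path_sum \<alpha> x v n"
  unfolding path_sum_def by (intro sum.cong) (auto simp: min_def)

lemma leaves_Cons_iff:
  assumes "0 < \<alpha>"
  shows "b # w \<in> leaves \<alpha> x t \<longleftrightarrow> w \<in> leaves \<alpha> (\<lambda>u. x (b # u)) (\<alpha> * (t - x []))"
  using assms unfolding leaves_def by (simp add: path_sum_Cons field_simps)

lemma leaves_negative: "0 < \<alpha> \<Longrightarrow> (\<And>u. 0 \<le> x u) \<Longrightarrow> t < 0 \<Longrightarrow> leaves \<alpha> x t = {}"
  unfolding leaves_def by (smt (verit) Collect_empty_eq path_sum_nonneg)

text \<open>
  Either the root is still alive at time \<open>t\<close>, or \<open>t - x []\<close> units of time remain for its two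
  subtrees; these are cascades whose clock runs \<open>\<alpha>\<close> times faster.
\<close>

lemma leaves_first_step:
  assumes \<alpha>: "0 < \<alpha>" and x: "\<And>u. 0 \<le> x u" and t: "0 \<le> t"
  shows "leaves \<alpha> x t =
    (if t < x [] then {[]}
     else Cons False ` leaves \<alpha> (\<lambda>u. x (False # u)) (\<alpha> * (t - x [])) \<union>
          Cons True ` leaves \<alpha> (\<lambda>u. x (True # u)) (\<alpha> * (t - x [])))"
proof (rule set_eqI)
  fix v
  have root: "[] \<in> leaves \<alpha> x t \<longleftrightarrow> t < x []"
    using t by (simp add: leaves_def path_sum_def)
  show "v \<in> leaves \<alpha> x t \<longleftrightarrow> v \<in> (if t < x [] then {[]}
     else Cons False ` leaves \<alpha> (\<lambda>u. x (False # u)) (\<alpha> * (t - x [])) \<union>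
          Cons True ` leaves \<alpha> (\<lambda>u. x (True # u)) (\<alpha> * (t - x [])))"
  proof (cases v)
    case Nil
    then show ?thesis using root by auto
  next
    case (Cons b w)
    have "leaves \<alpha> (\<lambda>u. x (b # u)) (\<alpha> * (t - x [])) = {}" if "t < x []"
      using that \<alpha> x by (intro leaves_negative) (auto simp: mult_pos_neg)
    then show ?thesis
      using Cons leaves_Cons_iff[OF \<alpha>, of b w x t] by (cases b) auto
  qed
qed

text \<open>
  Infinite sets get \<open>0\<close> even for \<open>r = 1\<close>, and \<open>0 ^ 0 = 1\<close>. So \<open>r = 1\<close> tests for finiteness,
  \<open>r = 0\<close> tests for emptiness, and the whole range of \<open>r\<close> obeys the same multiplicative law over
  the two subtrees.
\<close>

definition weight :: "real \<Rightarrow> 'v set \<Rightarrow> real" where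
  "weight r A = (if finite A then r ^ card A else 0)"

lemma weight_branch:
  "weight r (Cons False ` A \<union> Cons True ` B) = weight r A * weight r B"
proof (cases "finite A \<and> finite B")
  case True
  have "card (Cons False ` A \<union> Cons True ` B) = card A + card B"
    using True by (subst card_Un_disjoint) (auto simp: card_image)
  then show ?thesis using True by (simp add: weight_def power_add)
next
  case False
  then show ?thesis by (auto simp: weight_def finite_image_iff)
qed

lemma weight_nonneg: "0 \<le> r \<Longrightarrow> 0 \<le> weight r A"
  and weight_le_1: "0 \<le> r \<Longrightarrow> r \<le> 1 \<Longrightarrow> weight r A \<le> 1"
  and weight_mono: "0 \<le> r \<Longrightarrow> r \<le> s \<Longrightarrow> weight r A \<le> weight s A"
  by (auto simp: weight_def power_le_one power_mono)

lemma abs_weight_le_1: "0 \<le> r \<Longrightarrow> r \<le> 1 \<Longrightarrow> \<bar>weight r A\<bar> \<le> 1"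
  by (simp add: weight_nonneg weight_le_1)

lemma weight_at_0: "weight 0 A = indicator {{}} A"
  by (auto simp: weight_def indicator_def power_0_left)

lemma tendsto_weight: "f \<longlonglongrightarrow> r \<Longrightarrow> (\<lambda>n. weight (f n) A) \<longlonglongrightarrow> weight r A"
  by (auto simp: weight_def intro!: tendsto_power)

lemma weight_leaves_first_step:
  assumes "0 < \<alpha>" and "\<And>u. 0 \<le> x u" and "0 \<le> t"
  shows "weight r (leaves \<alpha> x t) =
    (if t < x [] then r
     else weight r (leaves \<alpha> (\<lambda>u. x (False # u)) (\<alpha> * (t - x []))) *
          weight r (leaves \<alpha> (\<lambda>u. x (True # u)) (\<alpha> * (t - x []))))"
  by (subst leaves_first_step[OF assms]) (auto simp: weight_branch, simp add: weight_def)

section \<open>The law of the cascade and its self-similarity\<close>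

definition exp_law :: "real measure" where
  "exp_law = density lborel (exponential_density 1)"

definition tree_law :: "(vertex \<Rightarrow> real) measure" where
  "tree_law = PiM UNIV (\<lambda>_. exp_law)"

text \<open>
  The inverse of cutting a cascade into its root value and its two subtrees.
\<close>

definition graft :: "real \<times> (vertex \<Rightarrow> real) \<times> (vertex \<Rightarrow> real) \<Rightarrow> vertex \<Rightarrow> real" where
  "graft = (\<lambda>(s, x, y) v. case v of [] \<Rightarrow> s | b # w \<Rightarrow> if b then y w else x w)"

lemma sets_exp_law [measurable_cong, simp]: "sets exp_law = sets borel"
  and space_exp_law [simp]: "space exp_law = UNIV"
  by (simp_all add: exp_law_def)

lemma prob_space_exp_law: "prob_space exp_law"
  unfolding exp_law_def by (rule prob_space_exponential_density) simp

interpretation exp_law: prob_space exp_law by (rule prob_space_exp_law)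

lemma sets_tree_law [measurable_cong]: "sets tree_law = sets (PiM UNIV (\<lambda>_. borel))"
  unfolding tree_law_def by (intro sets_PiM_cong) auto

lemma space_tree_law [simp]: "space tree_law = UNIV"
  by (simp add: tree_law_def space_PiM)

interpretation exp_product: product_prob_space "\<lambda>_::vertex. exp_law" UNIV ..

lemma prob_space_tree_law: "prob_space tree_law"
  unfolding tree_law_def by (rule prob_space_PiM) (rule prob_space_exp_law)

interpretation tree_law: prob_space tree_law by (rule prob_space_tree_law)

lemma measurable_tree_component [measurable]: "(\<lambda>x. x v) \<in> borel_measurable tree_law"
  by (subst measurable_cong_sets[OF sets_tree_law refl]) (rule measurable_component_singleton, simp)

lemma measurable_graft [measurable]:
  "graft \<in> measurable (exp_law \<Otimes>\<^sub>M tree_law \<Otimes>\<^sub>M tree_law) tree_law"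
proof -
  have "graft \<in> measurable (exp_law \<Otimes>\<^sub>M tree_law \<Otimes>\<^sub>M tree_law) (PiM UNIV (\<lambda>_. borel))"
  proof (rule measurable_PiM_single', goal_cases)
    case (1 v)
    show ?case
    proof (cases v)
      case Nil
      then show ?thesis by (simp add: graft_def case_prod_beta)
    next
      case (Cons b w)
      then show ?thesis by (cases b) (simp_all add: graft_def case_prod_beta)
    qed
  qed (auto)
  then show ?thesis by (simp cong: measurable_cong_sets add: sets_tree_law)
qed

lemma tree_law_box:
  assumes "finite J" "\<And>v. v \<in> J \<Longrightarrow> A v \<in> sets borel"
  shows "emeasure tree_law {x. \<forall>v\<in>J. x v \<in> A v} = (\<Prod>v\<in>J. emeasure exp_law (A v))"
  using exp_product.emeasure_PiM_Collect[of J A] assms by (simp add: tree_law_def space_PiM)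

text \<open>
  Self-similarity of the cascade: an independent root and two independent copies of the tree form
  again the tree. A product measure is determined by its values on boxes with finitely many
  constrained vertices, and the preimage of such a box under \<open>graft\<close> is a product of three boxes.
\<close>

lemma distr_graft:
  "distr (exp_law \<Otimes>\<^sub>M tree_law \<Otimes>\<^sub>M tree_law) tree_law graft = tree_law" (is "?D = _")
proof -
  interpret P: pair_prob_space tree_law tree_law ..
  have "?D = PiM UNIV (\<lambda>_. exp_law)"
  proof (rule exp_product.PiM_eq)
    show "sets ?D = sets (PiM UNIV (\<lambda>_. exp_law))"
      by (simp add: tree_law_def)
  next
    fix J :: "vertex set" and F :: "vertex \<Rightarrow> real set"
    assume J: "finite J" and F': "\<And>j. j \<in> J \<Longrightarrow> F j \<in> sets exp_law"
    \<comment> \<open>Constraining the root vacuously makes every box one over a set that contains the root.\<close>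
    define G where "G = (\<lambda>v. if v \<in> J then F v else UNIV)"
    have G[measurable]: "G v \<in> sets borel" for v using F' by (auto simp: G_def)
    define K where "K b = {w. b # w \<in> J}" for b
    have K: "finite (K b)" for b
    proof -
      have "K b = Cons b -` J" by (auto simp: K_def)
      then show ?thesis using J by (simp add: finite_vimageI)
    qed
    have split: "insert [] J = insert [] (Cons False ` K False \<union> Cons True ` K True)"
    proof (rule set_eqI)
      fix v show "v \<in> insert [] J \<longleftrightarrow> v \<in> insert [] (Cons False ` K False \<union> Cons True ` K True)"
        by (cases v; cases "hd v") (auto simp: K_def)
    qed
    have emb: "prod_emb UNIV (\<lambda>_. exp_law) J (Pi\<^sub>E J F) = {x. \<forall>v\<in>insert [] J. x v \<in> G v}"
      by (auto simp: prod_emb_def G_def PiE_iff)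
    let ?B = "\<lambda>b. {x. \<forall>w\<in>K b. x w \<in> G (b # w)}"
    have B: "?B b \<in> sets tree_law" for b
    proof -
      have "{x \<in> space tree_law. \<forall>w\<in>K b. x w \<in> G (b # w)} \<in> sets tree_law"
        using K[of b] by measurable
      then show ?thesis by simp
    qed
    have box: "{x. \<forall>v\<in>insert [] J. x v \<in> G v} \<in> sets tree_law"
    proof -
      have "{x \<in> space tree_law. \<forall>v\<in>insert [] J. x v \<in> G v} \<in> sets tree_law"
        using J by measurable
      then show ?thesis by simp
    qed
    have pre: "graft -` {x. \<forall>v\<in>insert [] J. x v \<in> G v} \<inter> space (exp_law \<Otimes>\<^sub>M tree_law \<Otimes>\<^sub>M tree_law)
      = G [] \<times> ?B False \<times> ?B True"
      unfolding split by (auto simp: graft_def space_pair_measure ball_Un)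
    have "emeasure ?D {x. \<forall>v\<in>insert [] J. x v \<in> G v} = emeasure exp_law (G []) *
        (emeasure tree_law (?B False) * emeasure tree_law (?B True))"
      using B box by (subst emeasure_distr) (simp_all only: pre measurable_graft,
        simp add: P.emeasure_pair_measure_Times tree_law.emeasure_pair_measure_Times)
    also have "\<dots> = emeasure exp_law (G []) *
        ((\<Prod>w\<in>K False. emeasure exp_law (G (False # w))) * (\<Prod>w\<in>K True. emeasure exp_law (G (True # w))))"
      by (subst (1 2) tree_law_box) (auto simp: K)
    also have "\<dots> = (\<Prod>v\<in>insert [] (Cons False ` K False \<union> Cons True ` K True). emeasure exp_law (G v))"
      using K by (subst prod.insert) (auto simp: prod.union_disjoint prod.reindex finite_imageI
        intro!: arg_cong2[where f="(*)"] prod.union_disjoint[symmetric, THEN trans[rotated]])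
    also have "\<dots> = (\<Prod>v\<in>J. emeasure exp_law (G v))"
      unfolding split[symmetric] using J exp_law.emeasure_space_1
      by (cases "[] \<in> J") (auto simp: insert_absorb G_def)
    also have "\<dots> = (\<Prod>v\<in>J. emeasure exp_law (F v))"
      by (intro prod.cong) (auto simp: G_def)
    finally show "emeasure ?D (prod_emb UNIV (\<lambda>_. exp_law) J (Pi\<^sub>E J F)) = (\<Prod>v\<in>J. emeasure exp_law (F v))"
      unfolding emb .
  qed
  then show ?thesis by (simp add: tree_law_def)
qed

lemma AE_tree_law_nonneg: "AE x in tree_law. \<forall>v. 0 \<le> x v"
proof -
  have "AE s in exp_law. 0 \<le> s"
    unfolding exp_law_def by (subst AE_density) (auto simp: exponential_density_def)
  then have "AE x in tree_law. 0 \<le> x v" for v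
    unfolding tree_law_def by (intro AE_PiM_component[OF prob_space_exp_law]) auto
  then show ?thesis by (simp add: AE_all_countable)
qed

lemma measurable_leaves_mem [measurable]:
  "Measurable.pred (borel \<Otimes>\<^sub>M tree_law) (\<lambda>p. v \<in> leaves \<alpha> (snd p) (fst p))"
  unfolding leaves_def path_sum_def mem_Collect_eq by measurable

text \<open>
  Stated through membership of single points, since sets of vertices carry no convenient sigma
  algebra; the enumeration of the countable ground type reduces it to sets of naturals.
\<close>

lemma measurable_weight:
  fixes V :: "'a \<Rightarrow> 'v::countable set"
  assumes [measurable]: "\<And>v. Measurable.pred N (\<lambda>x. v \<in> V x)"
  shows "(\<lambda>x. weight r (V x)) \<in> borel_measurable N"
proof -
  have eq: "weight r (V x) = weight r (to_nat ` V x)" for x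
    by (auto simp: weight_def finite_image_iff card_image)
  have [measurable]: "{x \<in> space N. i \<in> to_nat ` V x} \<in> sets N" for i
  proof -
    have "{x \<in> space N. \<exists>v. i = to_nat v \<and> v \<in> V x} \<in> sets N" by measurable
    then show ?thesis by (simp add: image_iff Bex_def conj_commute)
  qed
  show ?thesis unfolding eq unfolding weight_def by measurable
qed

lemma measurable_weight_leaves [measurable]:
  "(\<lambda>p. weight r (leaves \<alpha> (snd p) (fst p))) \<in> borel_measurable (borel \<Otimes>\<^sub>M tree_law)"
  by (rule measurable_weight) measurable

section \<open>The generating function of the number of leaves\<close>

text \<open>
  In \<open>r\<close> this is a probability generating function with the convention \<open>r\<^sup>\<infinity> = 0\<close>; in \<open>t\<close> it is
  the solution of the Riccati equation with initial value \<open>r\<close> that the cascade provides.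
\<close>

definition leaf_gf :: "real \<Rightarrow> real \<Rightarrow> real \<Rightarrow> real" where
  "leaf_gf \<alpha> r t = (\<integral>x. weight r (leaves \<alpha> x t) \<partial>tree_law)"

lemma measurable_weight_leaves_at [measurable]:
  "(\<lambda>x. weight r (leaves \<alpha> x t)) \<in> borel_measurable tree_law"
  using measurable_compose[OF measurable_Pair1' measurable_weight_leaves, of t r \<alpha>] by simp

lemma sets_finite_leaves: "{x. finite (leaves \<alpha> x t)} \<in> sets tree_law"
  and sets_no_leaves: "{x. leaves \<alpha> x t = {}} \<in> sets tree_law"
proof -
  have "{x \<in> space tree_law. weight 1 (leaves \<alpha> x t) = 1} \<in> sets tree_law"
    "{x \<in> space tree_law. weight 0 (leaves \<alpha> x t) = 1} \<in> sets tree_law" by measurable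
  moreover have "{x \<in> space tree_law. weight 1 (leaves \<alpha> x t) = 1} = {x. finite (leaves \<alpha> x t)}"
    "{x \<in> space tree_law. weight 0 (leaves \<alpha> x t) = 1} = {x. leaves \<alpha> x t = {}}"
    by (auto simp: weight_def power_0_left split: if_splits)
  ultimately show "{x. finite (leaves \<alpha> x t)} \<in> sets tree_law" "{x. leaves \<alpha> x t = {}} \<in> sets tree_law"
    by simp_all
qed

lemma integrable_weight_leaves:
  "0 \<le> r \<Longrightarrow> r \<le> 1 \<Longrightarrow> integrable tree_law (\<lambda>x. weight r (leaves \<alpha> x t))"
  by (rule tree_law.integrable_const_bound[where B=1]) (auto simp: weight_nonneg weight_le_1)

lemma borel_measurable_leaf_gf [measurable]: "leaf_gf \<alpha> r \<in> borel_measurable borel"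
  unfolding leaf_gf_def[abs_def]
  by (rule tree_law.borel_measurable_lebesgue_integral)
     (use measurable_weight_leaves[of r \<alpha>] in \<open>simp add: case_prod_beta\<close>)

lemma leaf_gf_nonneg: "0 \<le> r \<Longrightarrow> 0 \<le> leaf_gf \<alpha> r t"
  unfolding leaf_gf_def by (intro Bochner_Integration.integral_nonneg) (auto simp: weight_nonneg)

lemma leaf_gf_mono: "0 \<le> r \<Longrightarrow> r \<le> s \<Longrightarrow> s \<le> 1 \<Longrightarrow> leaf_gf \<alpha> r t \<le> leaf_gf \<alpha> s t"
  unfolding leaf_gf_def by (intro integral_mono integrable_weight_leaves weight_mono) auto

lemma leaf_gf_le_1: "0 \<le> r \<Longrightarrow> r \<le> 1 \<Longrightarrow> leaf_gf \<alpha> r t \<le> 1"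
  unfolding leaf_gf_def
  by (intro tree_law.integral_le_const integrable_weight_leaves) (auto simp: weight_le_1)

lemma leaf_gf_at_1: "leaf_gf \<alpha> 1 t = measure tree_law {x. finite (leaves \<alpha> x t)}"
proof -
  have "leaf_gf \<alpha> 1 t = (\<integral>x. indicator {x. finite (leaves \<alpha> x t)} x \<partial>tree_law)"
    unfolding leaf_gf_def by (intro Bochner_Integration.integral_cong) (auto simp: weight_def indicator_def)
  then show ?thesis by simp
qed

lemma leaf_gf_at_0: "leaf_gf \<alpha> 0 t = measure tree_law {x. leaves \<alpha> x t = {}}"
proof -
  have "leaf_gf \<alpha> 0 t = (\<integral>x. indicator {x. leaves \<alpha> x t = {}} x \<partial>tree_law)"
    unfolding leaf_gf_def by (intro Bochner_Integration.integral_cong)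
      (auto simp: weight_at_0 indicator_def)
  then show ?thesis by simp
qed

lemma leaf_gf_tendsto:
  assumes "f \<longlonglongrightarrow> r" and "\<And>n. 0 \<le> f n" and "\<And>n. f n \<le> 1"
  shows "(\<lambda>n. leaf_gf \<alpha> (f n) t) \<longlonglongrightarrow> leaf_gf \<alpha> r t"
  unfolding leaf_gf_def
  by (rule integral_dominated_convergence[where w="\<lambda>_. 1"])
     (use assms in \<open>auto intro!: tendsto_weight simp: weight_nonneg weight_le_1\<close>)

text \<open>
  Conditioning on the lifetime \<open>s\<close> of the root. The square comes from the independence of the two
  subtrees.
\<close>

lemma leaf_gf_first_step:
  assumes \<alpha>: "0 < \<alpha>" and r: "0 \<le> r" "r \<le> 1" and t: "0 \<le> t"
  shows "leaf_gf \<alpha> r t = (\<integral>s. (if t < s then r else (leaf_gf \<alpha> r (\<alpha> * (t - s)))\<^sup>2) \<partial>exp_law)"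
proof -
  interpret TT: pair_prob_space tree_law tree_law ..
  interpret ETT: pair_prob_space exp_law "tree_law \<Otimes>\<^sub>M tree_law" ..
  let ?P = "exp_law \<Otimes>\<^sub>M tree_law \<Otimes>\<^sub>M tree_law"
  let ?W = "\<lambda>x s. weight r (leaves \<alpha> x (\<alpha> * (t - s)))"
  let ?f = "\<lambda>(s, x, y). if t < s then r else ?W x s * ?W y s"
  have [measurable]: "(\<lambda>p. weight r (leaves \<alpha> (fst (snd p)) (\<alpha> * (t - fst p)))) \<in> borel_measurable ?P"
  proof -
    have "(\<lambda>p. (\<alpha> * (t - fst p), fst (snd p))) \<in> measurable ?P (borel \<Otimes>\<^sub>M tree_law)" by measurable
    from measurable_compose[OF this measurable_weight_leaves[of r \<alpha>]] show ?thesis by simp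
  qed
  have [measurable]: "(\<lambda>p. weight r (leaves \<alpha> (snd (snd p)) (\<alpha> * (t - fst p)))) \<in> borel_measurable ?P"
  proof -
    have "(\<lambda>p. (\<alpha> * (t - fst p), snd (snd p))) \<in> measurable ?P (borel \<Otimes>\<^sub>M tree_law)" by measurable
    from measurable_compose[OF this measurable_weight_leaves[of r \<alpha>]] show ?thesis by simp
  qed
  have f_meas [measurable]: "?f \<in> borel_measurable ?P"
    unfolding case_prod_beta by measurable
  have bound: "norm (?f p) \<le> 1" for p
    using r by (auto simp: case_prod_beta abs_mult intro!: mult_le_one abs_weight_le_1)
  have int: "integrable ?P ?f"
    by (rule ETT.P.integrable_const_bound[where B=1]) (use bound in auto)
  have prod: "(\<integral>q. ?W (fst q) s * ?W (snd q) s \<partial>(tree_law \<Otimes>\<^sub>M tree_law)) = (leaf_gf \<alpha> r (\<alpha> * (t - s)))\<^sup>2" for s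
  proof -
    have "integrable (tree_law \<Otimes>\<^sub>M tree_law) (\<lambda>q. ?W (fst q) s * ?W (snd q) s)"
      using r by (intro TT.P.integrable_const_bound[where B=1])
        (auto simp: abs_mult weight_le_1 weight_nonneg intro!: mult_le_one)
    from TT.integral_fst'[OF this] show ?thesis
      by (simp add: leaf_gf_def power2_eq_square)
  qed
  have nn: "AE p in ?P. \<forall>v. 0 \<le> graft p v"
  proof (rule AE_distrD[OF measurable_graft])
    show "AE x in distr ?P tree_law graft. \<forall>v. 0 \<le> x v"
      unfolding distr_graft by (rule AE_tree_law_nonneg)
  qed
  have "leaf_gf \<alpha> r t = (\<integral>x. weight r (leaves \<alpha> x t) \<partial>distr ?P tree_law graft)"
    by (simp add: leaf_gf_def distr_graft)
  also have "\<dots> = (\<integral>p. weight r (leaves \<alpha> (graft p) t) \<partial>?P)"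
    by (rule integral_distr) measurable
  also have "\<dots> = (\<integral>p. ?f p \<partial>?P)"
  proof (rule integral_cong_AE)
    show "AE p in ?P. weight r (leaves \<alpha> (graft p) t) = ?f p"
      using nn by eventually_elim
        (subst weight_leaves_first_step, use \<alpha> t in \<open>auto simp: graft_def split: prod.splits\<close>)
  qed measurable
  also have "\<dots> = (\<integral>s. (\<integral>q. ?f (s, q) \<partial>(tree_law \<Otimes>\<^sub>M tree_law)) \<partial>exp_law)"
    by (rule ETT.integral_fst'[OF int, symmetric])
  also have "\<dots> = (\<integral>s. (if t < s then r else (leaf_gf \<alpha> r (\<alpha> * (t - s)))\<^sup>2) \<partial>exp_law)"
    by (intro Bochner_Integration.integral_cong)
      (auto simp: case_prod_beta prod TT.P.prob_space)
  finally show ?thesis .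
qed

lemma exp_law_tail: "0 \<le> a \<Longrightarrow> measure exp_law {a<..} = exp (- a)"
proof -
  assume "0 \<le> a"
  have "distributed exp_law lborel (\<lambda>x. x) (exponential_density 1)"
    by (simp add: distributed_def exp_law_def distr_id2)
  from exp_law.exponential_distributedD_gt[OF this \<open>0 \<le> a\<close>] show ?thesis
    by (simp add: greaterThan_def)
qed

text \<open>
  The reflection \<open>s \<mapsto> t - s\<close> turns the expectation over an exponential time into an integral
  with the variable end point only in its domain, so that it can be differentiated in \<open>t\<close>.
\<close>

lemma integral_exp_law_convolution:
  fixes h :: "real \<Rightarrow> real"
  assumes [measurable]: "h \<in> borel_measurable borel" and h: "\<And>s. \<bar>h s\<bar> \<le> B" and t: "0 \<le> t"
  shows "(\<lambda>s. exp s * h s) integrable_on {0..t}"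
    and "exp t * (\<integral>s. (if t < s then r else h (t - s)) \<partial>exp_law) = r + integral {0..t} (\<lambda>s. exp s * h s)"
proof -
  have int: "set_integrable lborel {0..t} (\<lambda>s. exp s * h s)"
    unfolding set_integrable_def
  proof (rule integrableI_bounded_set_indicator[where B="exp t * B"])
    show "AE x in lborel. x \<in> {0..t} \<longrightarrow> norm (exp x * h x) \<le> exp t * B"
      using h by (auto simp: abs_mult intro!: mult_mono)
  qed (use t in auto)
  show "(\<lambda>s. exp s * h s) integrable_on {0..t}"
    using set_borel_integral_eq_integral(1)[OF int] .
  have B: "0 \<le> B" using h[of 0] by linarith
  have h_meas: "(\<lambda>s. h (t - s)) \<in> borel_measurable exp_law"
    unfolding measurable_cong_sets[OF sets_exp_law refl] by measurable
  have "(\<integral>s. (if t < s then r else h (t - s)) \<partial>exp_law)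
      = (\<integral>s. r * indicator {t<..} s + indicator {..t} s * h (t - s) \<partial>exp_law)"
    by (intro Bochner_Integration.integral_cong) (auto simp: indicator_def)
  also have "\<dots> = (\<integral>s. r * indicator {t<..} s \<partial>exp_law) + (\<integral>s. indicator {..t} s * h (t - s) \<partial>exp_law)"
  proof (intro Bochner_Integration.integral_add)
    show "integrable exp_law (\<lambda>s. r * indicator {t<..} s)"
      by (rule exp_law.integrable_const_bound[where B="\<bar>r\<bar>"]) (auto simp: indicator_def)
    show "integrable exp_law (\<lambda>s. indicator {..t} s * h (t - s))"
    proof (rule exp_law.integrable_const_bound[where B=B])
      show "AE s in exp_law. norm (indicator {..t} s * h (t - s)) \<le> B"
        by (auto simp: indicator_def h B)
      show "(\<lambda>s. indicator {..t} s * h (t - s)) \<in> borel_measurable exp_law"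
        by (rule borel_measurable_times[OF borel_measurable_indicator h_meas]) simp
    qed
  qed
  also have "(\<integral>s. r * indicator {t<..} s \<partial>exp_law) = r * exp (- t)"
    using exp_law_tail[OF t] by simp
  also have "(\<integral>s. indicator {..t} s * h (t - s) \<partial>exp_law)
      = (\<integral>s. exponential_density 1 s * (indicator {..t} s * h (t - s)) \<partial>lborel)"
    unfolding exp_law_def by (subst integral_density) (auto simp: exponential_density_nonneg)
  also have "\<dots> = (\<integral>s. exponential_density 1 (t - s) * (indicator {..t} (t - s) * h s) \<partial>lborel)"
    using lborel_integral_real_affine[of "- 1" "\<lambda>s. exponential_density 1 s * (indicator {..t} s * h (t - s))" t]
    by simp
  also have "\<dots> = (\<integral>s. exp (- t) * (indicator {0..t} s *\<^sub>R (exp s * h s)) \<partial>lborel)"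
    by (intro Bochner_Integration.integral_cong)
       (auto simp: indicator_def exponential_density_def exp_diff exp_minus field_simps)
  also have "\<dots> = exp (- t) * (LINT s:{0..t}|lborel. exp s * h s)"
    by (simp add: set_lebesgue_integral_def)
  also have "(LINT s:{0..t}|lborel. exp s * h s) = integral {0..t} (\<lambda>s. exp s * h s)"
    by (rule set_borel_integral_eq_integral(2)[OF int])
  finally show "exp t * (\<integral>s. (if t < s then r else h (t - s)) \<partial>exp_law)
      = r + integral {0..t} (\<lambda>s. exp s * h s)"
    by (simp add: algebra_simps exp_minus)
qed

text \<open>
  The mild form of the Riccati equation with initial value \<open>r\<close>. Starting from
  mere measurability in time, it yields continuity and then differentiability.
\<close>

lemma leaf_gf_integral_equation:
  assumes \<alpha>: "0 < \<alpha>" and r: "0 \<le> r" "r \<le> 1" and t: "0 \<le> t"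
  shows "(\<lambda>s. exp s * (leaf_gf \<alpha> r (\<alpha> * s))\<^sup>2) integrable_on {0..t}"
    and "exp t * leaf_gf \<alpha> r t = r + integral {0..t} (\<lambda>s. exp s * (leaf_gf \<alpha> r (\<alpha> * s))\<^sup>2)"
proof -
  have "\<bar>(leaf_gf \<alpha> r (\<alpha> * s))\<^sup>2\<bar> \<le> 1" for s
    using r by (simp add: power_le_one leaf_gf_nonneg leaf_gf_le_1)
  note conv = integral_exp_law_convolution[OF _ this t]
  show "(\<lambda>s. exp s * (leaf_gf \<alpha> r (\<alpha> * s))\<^sup>2) integrable_on {0..t}"
    by (rule conv(1)) measurable
  show "exp t * leaf_gf \<alpha> r t = r + integral {0..t} (\<lambda>s. exp s * (leaf_gf \<alpha> r (\<alpha> * s))\<^sup>2)"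
    unfolding leaf_gf_first_step[OF assms] by (rule conv(2)) measurable
qed

section \<open>Regularity and the differential equation\<close>

lemma continuous_on_half_line:
  fixes f :: "real \<Rightarrow> 'b::topological_space"
  assumes "\<And>b. continuous_on {a..b} f"
  shows "continuous_on {a..} f"
  unfolding continuous_on_eq_continuous_within
proof
  fix x assume "x \<in> {a..}"
  then have "continuous (at x within {a..x+1}) f"
    using assms[of "x + 1"] by (simp add: continuous_on_eq_continuous_within)
  moreover have "at x within {a..} = at x within {a..x+1}"
    by (rule at_within_nhd[of x "{..<x+1}"]) auto
  ultimately show "continuous (at x within {a..}) f" by simp
qed

lemma continuous_on_integral_half_line:
  fixes g :: "real \<Rightarrow> real"
  assumes "\<And>b. a \<le> b \<Longrightarrow> g integrable_on {a..b}"
  shows "continuous_on {a..} (\<lambda>t. integral {a..t} g)"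
proof (rule continuous_on_half_line)
  fix b show "continuous_on {a..b} (\<lambda>t. integral {a..t} g)"
    using assms by (cases "a \<le> b") (auto intro: indefinite_integral_continuous_1)
qed

lemma has_real_derivative_integral_half_line:
  fixes g :: "real \<Rightarrow> real"
  assumes "continuous_on {a..} g" and "a < t"
  shows "((\<lambda>t. integral {a..t} g) has_real_derivative g t) (at t)"
proof -
  have "((\<lambda>t. integral {a..t} g) has_real_derivative g t) (at t within {a..t+1})"
    using assms by (intro integral_has_real_derivative) (auto intro: continuous_on_subset)
  moreover have "at t within {a..t+1} = at t"
    using assms by (intro at_within_interior) auto
  ultimately show ?thesis by simp
qed

lemma continuous_on_leaf_gf:
  assumes \<alpha>: "0 < \<alpha>" and r: "0 \<le> r" "r \<le> 1"
  shows "continuous_on {0..} (leaf_gf \<alpha> r)"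
proof -
  let ?I = "\<lambda>t. integral {0..t} (\<lambda>s. exp s * (leaf_gf \<alpha> r (\<alpha> * s))\<^sup>2)"
  have "continuous_on {0..} (\<lambda>t. exp (- t) * (r + ?I t))"
    using leaf_gf_integral_equation(1)[OF assms]
    by (intro continuous_intros continuous_on_integral_half_line) auto
  then show ?thesis
  proof (rule continuous_on_eq)
    show "exp (- t) * (r + ?I t) = leaf_gf \<alpha> r t" if "t \<in> {0..}" for t
      using that by (subst leaf_gf_integral_equation(2)[OF assms, symmetric]) (auto simp: exp_minus)
  qed
qed

lemma leaf_gf_has_real_derivative:
  assumes \<alpha>: "0 < \<alpha>" and r: "0 \<le> r" "r \<le> 1" and t: "0 < t"
  shows "(leaf_gf \<alpha> r has_real_derivative (leaf_gf \<alpha> r (\<alpha> * t))\<^sup>2 - leaf_gf \<alpha> r t) (at t)"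
proof -
  let ?g = "\<lambda>s. exp s * (leaf_gf \<alpha> r (\<alpha> * s))\<^sup>2"
  let ?I = "\<lambda>t. integral {0..t} ?g"
  have "continuous_on {0..} ?g"
    using \<alpha> by (intro continuous_intros continuous_on_compose2[OF continuous_on_leaf_gf[OF \<alpha> r]]) auto
  from has_real_derivative_integral_half_line[OF this t]
  have D: "(?I has_real_derivative ?g t) (at t)" .
  have eq: "exp (- u) * (r + ?I u) = leaf_gf \<alpha> r u" if "0 \<le> u" for u
    using that by (subst leaf_gf_integral_equation(2)[OF \<alpha> r, symmetric]) (auto simp: exp_minus)
  have "((\<lambda>t. exp (- t) * (r + ?I t)) has_real_derivative
      exp (- t) * ?g t - exp (- t) * (r + ?I t)) (at t)"
    by (auto intro!: derivative_eq_intros D)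
  also have "exp (- t) * ?g t - exp (- t) * (r + ?I t) = (leaf_gf \<alpha> r (\<alpha> * t))\<^sup>2 - leaf_gf \<alpha> r t"
    using eq[of t] t by (simp add: exp_minus)
  finally have D': "((\<lambda>t. exp (- t) * (r + ?I t)) has_real_derivative
      (leaf_gf \<alpha> r (\<alpha> * t))\<^sup>2 - leaf_gf \<alpha> r t) (at t)" .
  show ?thesis
    by (rule has_field_derivative_transform_within_open[OF D', of "{0<..}"]) (use t eq in auto)
qed

lemma leaf_gf_0: "0 < \<alpha> \<Longrightarrow> 0 \<le> r \<Longrightarrow> r \<le> 1 \<Longrightarrow> leaf_gf \<alpha> r 0 = r"
  using leaf_gf_integral_equation(2)[of \<alpha> r 0] by simp

text \<open>
  A nonnegative integrand with vanishing integral over \<open>[0, t]\<close> vanishes, and because of the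
  dilation by \<open>\<alpha> > 1\<close> this controls \<open>g\<close> on the longer interval \<open>[0, \<alpha> t]\<close>. Iterating
  covers the half-line. It serves twice: a generating function that starts from one of
  the trivial solutions \<open>0\<close> and \<open>1\<close> and meets it again at a later time coincides with it.
\<close>

lemma vanishing_spreads:
  fixes g h :: "real \<Rightarrow> real"
  assumes \<alpha>: "1 < \<alpha>"
    and cont: "continuous_on {0..} h" and nonneg: "\<And>x. 0 \<le> x \<Longrightarrow> 0 \<le> h x"
    and eq: "\<And>t. 0 \<le> t \<Longrightarrow> exp t * g t = integral {0..t} (\<lambda>s. exp s * h (\<alpha> * s))"
    and imp: "\<And>x. 0 \<le> x \<Longrightarrow> h x = 0 \<Longrightarrow> g x = 0"
    and t: "0 < t" "g t = 0" and x: "0 \<le> x"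
  shows "g x = 0"
proof -
  have step: "g y = 0" if "0 < u" "g u = 0" "0 \<le> y" "y \<le> \<alpha> * u" for u y
  proof -
    have "integral {0..u} (\<lambda>s. exp s * h (\<alpha> * s)) = 0"
      using eq[of u] that by simp
    moreover have "continuous_on {0..u} (\<lambda>s. exp s * h (\<alpha> * s))"
      using \<alpha> by (intro continuous_intros continuous_on_compose2[OF cont]) auto
    ultimately have "\<forall>s\<in>{0..u}. exp s * h (\<alpha> * s) = 0"
      using \<open>0 < u\<close> \<alpha> nonneg by (subst (asm) integral_eq_0_iff) auto
    moreover have "y / \<alpha> \<in> {0..u}"
      using that \<alpha> by (simp add: divide_le_eq mult.commute)
    ultimately have "exp (y / \<alpha>) * h (\<alpha> * (y / \<alpha>)) = 0"
      by (rule bspec)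
    then show "g y = 0" using imp that \<alpha> by simp
  qed
  have scaled: "g (\<alpha> ^ n * t) = 0" for n
  proof (induction n)
    case (Suc n)
    have "0 < \<alpha> ^ n * t" using \<alpha> t by simp
    from step[OF this Suc.IH, of "\<alpha> ^ Suc n * t"] show ?case
      using \<alpha> t by (simp add: mult.assoc)
  qed (use t in simp)
  obtain n where "x / t < \<alpha> ^ n" using real_arch_pow[OF \<alpha>] by blast
  then have "x \<le> \<alpha> ^ n * t"
    using t by (simp add: divide_less_eq)
  also have "\<dots> \<le> \<alpha> * (\<alpha> ^ n * t)"
    using \<alpha> t by simp
  finally have "x \<le> \<alpha> * (\<alpha> ^ n * t)" .
  then show ?thesis using step[OF _ scaled[of n]] \<alpha> t x by auto
qed

lemma leaf_gf_0_vanishing: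
  assumes "1 < \<alpha>" "0 < t" "leaf_gf \<alpha> 0 t = 0" "0 \<le> x"
  shows "leaf_gf \<alpha> 0 x = 0"
proof (rule vanishing_spreads[OF assms(1), of "\<lambda>x. (leaf_gf \<alpha> 0 x)\<^sup>2" "leaf_gf \<alpha> 0" t])
  show "continuous_on {0..} (\<lambda>x. (leaf_gf \<alpha> 0 x)\<^sup>2)"
    using assms by (intro continuous_intros continuous_on_leaf_gf) auto
  show "exp t * leaf_gf \<alpha> 0 t = integral {0..t} (\<lambda>s. exp s * (leaf_gf \<alpha> 0 (\<alpha> * s))\<^sup>2)"
    if "0 \<le> t" for t
    using leaf_gf_integral_equation(2)[of \<alpha> 0 t] assms that by simp
qed (use assms in auto)

lemma leaf_gf_1_saturated:
  assumes "1 < \<alpha>" "0 < t" "leaf_gf \<alpha> 1 t = 1" "0 \<le> x"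
  shows "leaf_gf \<alpha> 1 x = 1"
proof -
  let ?u = "leaf_gf \<alpha> 1"
  have u: "0 \<le> ?u x" "?u x \<le> 1" for x
    by (auto simp: leaf_gf_nonneg leaf_gf_le_1)
  have "1 - ?u x = 0"
  proof (rule vanishing_spreads[OF assms(1), of "\<lambda>x. 1 - (?u x)\<^sup>2" "\<lambda>x. 1 - ?u x" t])
    show "continuous_on {0..} (\<lambda>x. 1 - (?u x)\<^sup>2)"
      using assms by (intro continuous_intros continuous_on_leaf_gf) auto
    show "exp t * (1 - ?u t) = integral {0..t} (\<lambda>s. exp s * (1 - (?u (\<alpha> * s))\<^sup>2))" if t: "0 \<le> t" for t
    proof -
      have E: "(exp has_integral exp t - exp 0) {0..t::real}"
        by (rule fundamental_theorem_of_calculus[OF t])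
           (auto intro!: derivative_eq_intros simp: has_real_derivative_iff_has_vector_derivative[symmetric])
      have eqn: "exp t * ?u t = 1 + integral {0..t} (\<lambda>s. exp s * (?u (\<alpha> * s))\<^sup>2)"
        and int: "(\<lambda>s. exp s * (?u (\<alpha> * s))\<^sup>2) integrable_on {0..t}"
        using leaf_gf_integral_equation[of \<alpha> 1 t] assms t by auto
      have "integral {0..t} (\<lambda>s. exp s * (1 - (?u (\<alpha> * s))\<^sup>2))
          = integral {0..t} (\<lambda>s. exp s - exp s * (?u (\<alpha> * s))\<^sup>2)"
        by (simp add: algebra_simps)
      also have "\<dots> = integral {0..t} exp - integral {0..t} (\<lambda>s. exp s * (?u (\<alpha> * s))\<^sup>2)"
        using E int by (intro integral_diff) auto
      also have "integral {0..t} exp = exp t - 1"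
        using integral_unique[OF E] by simp
      finally show ?thesis using eqn by (simp add: algebra_simps)
    qed
    show "1 - ?u x = 0" if "1 - (?u x)\<^sup>2 = 0" for x
      using that u[of x] by (simp add: power2_eq_1_iff)
  qed (use assms u in \<open>simp_all add: power_le_one\<close>)
  then show ?thesis by simp
qed

section \<open>Late times and the deficit\<close>

text \<open>
  The longest path of the cascade is almost surely finite, so at late times there are no leaves
  at all. The lifetime at \<open>v\<close> exceeds \<open>c (|v| + 1)\<close> with probability \<open>exp (- c) ^ (|v| + 1)\<close>,
  which beats the \<open>2 ^ n\<close> vertices of height \<open>n\<close> when \<open>c\<close> is large. Outside this event every path
  sum is at most \<open>c K\<close> with \<open>K\<close> the sum of \<open>(j + 1) / \<alpha> ^ j\<close>, which converges as \<open>\<alpha> > 1\<close>.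
\<close>

lemma leaf_gf_0_near_1:
  assumes \<alpha>: "1 < \<alpha>" and \<epsilon>: "0 < \<epsilon>"
  obtains R where "\<And>t. R \<le> t \<Longrightarrow> 1 - \<epsilon> < leaf_gf \<alpha> 0 t"
proof -
  define q where "q = min (1 / 4) (\<epsilon> / 4)"
  define c where "c = - ln q"
  have q: "0 < q" "q \<le> 1 / 4" "4 * q \<le> \<epsilon>" using \<epsilon> by (auto simp: q_def)
  have c: "0 < c" "exp (- c) = q" using q by (auto simp: c_def ln_less_zero_iff)
  define K where "K = (\<Sum>j. real (Suc j) * (1 / \<alpha>) ^ j)"
  have K: "summable (\<lambda>j. real (Suc j) * (1 / \<alpha>) ^ j)"
    using geometric_deriv_sums[of "1 / \<alpha>"] \<alpha> by (auto simp: sums_iff)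
  define Bad where "Bad n = (\<Union>v\<in>{v. length v = n}. {x :: vertex \<Rightarrow> real. c * real (Suc n) < x v})" for n
  have fin: "finite {v :: vertex. length v = n}" for n
    using finite_lists_length_eq[of "UNIV :: bool set" n] by simp
  have card: "card {v :: vertex. length v = n} = 2 ^ n" for n
    using card_lists_length_eq[of "UNIV :: bool set" n] by simp
  have meas1: "{x. a < x v} \<in> sets tree_law" for a v
  proof -
    have "{x \<in> space tree_law. a < x v} \<in> sets tree_law" by measurable
    then show ?thesis by simp
  qed
  have meas: "Bad n \<in> sets tree_law" for n
    unfolding Bad_def using fin meas1 by (intro sets.finite_UN) auto
  have Bad: "measure tree_law (Bad n) \<le> q * (2 * q) ^ n" for n
  proof -
    have "measure tree_law (Bad n) \<le> (\<Sum>v\<in>{v :: vertex. length v = n}. measure tree_law {x. c * real (Suc n) < x v})"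
      unfolding Bad_def using fin meas1 by (intro tree_law.finite_measure_subadditive_finite) auto
    also have "\<dots> = (\<Sum>v\<in>{v :: vertex. length v = n}. q ^ Suc n)"
    proof (intro sum.cong refl)
      fix v :: vertex
      have "measure tree_law {x. c * real (Suc n) < x v} = measure exp_law {c * real (Suc n)<..}"
        using tree_law_box[of "{v}" "\<lambda>_. {c * real (Suc n)<..}"] by (simp add: measure_def)
      also have "\<dots> = q ^ Suc n"
        using c(1) exp_of_nat_mult[of "Suc n" "- c"]
        by (subst exp_law_tail) (auto simp: c(2)[symmetric] mult.commute)
      finally show "measure tree_law {x. c * real (Suc n) < x v} = q ^ Suc n" .
    qed
    also have "\<dots> = q * (2 * q) ^ n" by (simp add: card power_mult_distrib)
    finally show ?thesis .
  qed
  have geo: "(\<lambda>n. q * (2 * q) ^ n) sums (q * (1 / (1 - 2 * q)))"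
    using q by (intro sums_mult geometric_sums) auto
  have sum_Bad: "summable (\<lambda>n. measure tree_law (Bad n))"
    by (rule summable_comparison_test'[OF sums_summable[OF geo], of 0]) (use Bad in auto)
  have "measure tree_law (\<Union>n. Bad n) \<le> (\<Sum>n. measure tree_law (Bad n))"
    using meas sum_Bad by (intro tree_law.finite_measure_subadditive_countably) auto
  also have "\<dots> \<le> q * (1 / (1 - 2 * q))"
    using suminf_le[OF Bad sum_Bad sums_summable[OF geo]] sums_unique[OF geo] by simp
  also have "\<dots> \<le> 2 * q"
    using q by (simp add: field_simps)
  also have "\<dots> < \<epsilon>" using q by linarith
  finally have small: "measure tree_law (\<Union>n. Bad n) < \<epsilon>" .
  have no_leaves: "leaves \<alpha> x t = {}" if x: "x \<notin> (\<Union>n. Bad n)" and t: "c * K \<le> t" for x t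
  proof -
    have bound: "x v \<le> c * real (Suc (length v))" for v
      using x by (auto simp: Bad_def not_less)
    have "path_sum \<alpha> x v n \<le> t" if n: "n \<le> Suc (length v)" for v n
    proof -
      have "path_sum \<alpha> x v n \<le> (\<Sum>j<n. c * (real (Suc j) * (1 / \<alpha>) ^ j))"
        unfolding path_sum_def
      proof (intro sum_mono)
        fix j assume "j \<in> {..<n}"
        then have "length (take j v) = j" using n by auto
        then show "x (take j v) / \<alpha> ^ j \<le> c * (real (Suc j) * (1 / \<alpha>) ^ j)"
          using bound[of "take j v"] \<alpha> by (simp add: field_simps power_divide)
      qed
      also have "\<dots> = c * (\<Sum>j<n. real (Suc j) * (1 / \<alpha>) ^ j)"
        by (simp add: sum_distrib_left)
      also have "\<dots> \<le> c * K"
        unfolding K_def using c \<alpha> by (intro mult_left_mono sum_le_suminf K) auto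
      finally show ?thesis using t by linarith
    qed
    then show ?thesis unfolding leaves_def by (force simp: not_less)
  qed
  have "1 - \<epsilon> < leaf_gf \<alpha> 0 t" if t: "c * K \<le> t" for t
  proof -
    have "1 - \<epsilon> < 1 - measure tree_law (\<Union>n. Bad n)" using small by simp
    also have "\<dots> = measure tree_law (space tree_law - (\<Union>n. Bad n))"
      using meas by (subst tree_law.prob_compl) auto
    also have "\<dots> \<le> leaf_gf \<alpha> 0 t"
      unfolding leaf_gf_at_0 using no_leaves t sets_no_leaves
      by (intro tree_law.finite_measure_mono) auto
    finally show ?thesis .
  qed
  then show ?thesis by (rule that)
qed

lemma leaf_gf_0_pos:
  assumes "1 < \<alpha>" "0 < t"
  shows "0 < leaf_gf \<alpha> 0 t"
proof (rule ccontr)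
  assume "\<not> 0 < leaf_gf \<alpha> 0 t"
  then have "leaf_gf \<alpha> 0 t = 0" using leaf_gf_nonneg[of 0 \<alpha> t] by simp
  then have zero: "leaf_gf \<alpha> 0 x = 0" if "0 \<le> x" for x
    using leaf_gf_0_vanishing assms that by blast
  obtain R where "\<And>t. R \<le> t \<Longrightarrow> 1 - 1 < leaf_gf \<alpha> 0 t"
    using leaf_gf_0_near_1[of \<alpha> 1] assms by auto
  from this[of "max 0 R"] zero[of "max 0 R"] show False by simp
qed

text \<open>
  The place where \<open>\<alpha> < 2\<close> enters. The deficit \<open>d = 1 - leaf_gf \<alpha> r\<close> satisfies
  \<open>d' + d = 2 d(\<alpha> t) - d(\<alpha> t)\<^sup>2\<close>. Rescaling the integral of the linear term on the right only
  costs a factor \<open>\<alpha> < 2\<close>, so a solution with \<open>d \<le> 2 - \<alpha>\<close> everywhere reproduces more mass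
  than is lost and can never fall below its initial value \<open>1 - r > 0\<close>. But \<open>d\<close> tends to \<open>0\<close>.
  The lower bound for the supremum of \<open>d\<close> does not depend on \<open>r\<close>, even though \<open>d 0\<close> tends to \<open>0\<close>
  as \<open>r\<close> tends to \<open>1\<close>.
\<close>

lemma leaf_gf_deficit_large:
  assumes \<alpha>: "1 < \<alpha>" "\<alpha> < 2" and r: "0 \<le> r" "r < 1"
  obtains t where "0 \<le> t" "2 - \<alpha> < 1 - leaf_gf \<alpha> r t"
proof (rule ccontr)
  assume "\<not> thesis"
  then have small: "1 - leaf_gf \<alpha> r t \<le> 2 - \<alpha>" if "0 \<le> t" for t
    using that \<open>\<And>t. 0 \<le> t \<Longrightarrow> 2 - \<alpha> < 1 - leaf_gf \<alpha> r t \<Longrightarrow> thesis\<close> not_less by blast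
  define d where "d t = 1 - leaf_gf \<alpha> r t" for t
  have d: "0 \<le> d t" for t using r by (simp add: d_def leaf_gf_le_1)
  have cont: "continuous_on {0..} d"
    unfolding d_def using \<alpha> r by (intro continuous_intros continuous_on_leaf_gf) auto
  define D where "D t = integral {0..t} d" for t
  have int: "d integrable_on {0..b}" for b
    by (intro integrable_continuous_real continuous_on_subset[OF cont]) auto
  have contD: "continuous_on {0..} D"
    unfolding D_def by (rule continuous_on_integral_half_line) (rule int)
  have derivD: "(D has_real_derivative d t) (at t)" if "0 < t" for t
    unfolding D_def using cont that by (rule has_real_derivative_integral_half_line)
  \<comment> \<open>The derivative of this function is \<open>d(\<alpha> t) (2 - \<alpha> - d(\<alpha> t))\<close>.\<close>
  define F where "F t = d t + D t - D (\<alpha> * t)" for t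
  have "1 - r \<le> d R" if R: "0 \<le> R" for R
  proof -
    have "F 0 \<le> F R"
    proof (rule DERIV_nonneg_imp_increasing_open[OF R])
      fix t assume t: "0 < t" "t < R"
      have "(d has_real_derivative - ((leaf_gf \<alpha> r (\<alpha> * t))\<^sup>2 - leaf_gf \<alpha> r t)) (at t)"
        unfolding d_def using leaf_gf_has_real_derivative[of \<alpha> r t] \<alpha> r t
        by (auto intro!: derivative_eq_intros)
      moreover have "((\<lambda>t. D (\<alpha> * t)) has_real_derivative d (\<alpha> * t) * \<alpha>) (at t)"
        by (rule DERIV_chain2[OF derivD]) (use \<alpha> t in \<open>auto intro!: derivative_eq_intros\<close>)
      ultimately have "(F has_real_derivative
          - ((leaf_gf \<alpha> r (\<alpha> * t))\<^sup>2 - leaf_gf \<alpha> r t) + d t - d (\<alpha> * t) * \<alpha>) (at t)"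
        unfolding F_def using derivD[OF t(1)] by (auto intro!: derivative_intros)
      also have "- ((leaf_gf \<alpha> r (\<alpha> * t))\<^sup>2 - leaf_gf \<alpha> r t) + d t - d (\<alpha> * t) * \<alpha>
          = d (\<alpha> * t) * (2 - \<alpha> - d (\<alpha> * t))"
        by (simp add: d_def power2_eq_square algebra_simps)
      finally have "(F has_real_derivative d (\<alpha> * t) * (2 - \<alpha> - d (\<alpha> * t))) (at t)" .
      moreover have "0 \<le> d (\<alpha> * t) * (2 - \<alpha> - d (\<alpha> * t))"
        using d small[of "\<alpha> * t"] \<alpha> t by (intro mult_nonneg_nonneg) (auto simp: d_def)
      ultimately show "\<exists>y. (F has_real_derivative y) (at t) \<and> 0 \<le> y" by blast
    next
      have "continuous_on {0..} F"
        unfolding F_def using \<alpha>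
        by (intro continuous_intros cont contD continuous_on_compose2[OF contD]) auto
      then show "continuous_on {0..R} F" by (rule continuous_on_subset) auto
    qed
    moreover have "F 0 = 1 - r"
      using \<alpha> r by (simp add: F_def d_def leaf_gf_0)
    moreover have "D R \<le> D (\<alpha> * R)"
      unfolding D_def using R \<alpha> d int by (intro integral_subset_le) (auto simp: mult_le_cancel_right1)
    ultimately show ?thesis by (simp add: F_def)
  qed
  moreover obtain R where "\<And>t. R \<le> t \<Longrightarrow> 1 - (1 - r) < leaf_gf \<alpha> 0 t"
    using leaf_gf_0_near_1[of \<alpha> "1 - r"] \<alpha> r by auto
  ultimately have "1 - r \<le> d (max 0 R)" "r < leaf_gf \<alpha> 0 (max 0 R)" by force+
  moreover have "leaf_gf \<alpha> 0 (max 0 R) \<le> leaf_gf \<alpha> r (max 0 R)"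
    using r by (intro leaf_gf_mono) auto
  ultimately show False by (simp add: d_def)
qed

text \<open>
  Large deficits survive the limit \<open>r \<rightarrow> 1\<close>: they occur at times \<open>s n\<close> that stay bounded, since
  every deficit is dominated by the one for \<open>r = 0\<close>, and the deficits decrease in \<open>r\<close>. The argument
  at an accumulation point \<open>\<tau>\<close> of these times is that of Dini's theorem.
\<close>

lemma leaf_gf_1_less_somewhere:
  assumes \<alpha>: "1 < \<alpha>" "\<alpha> < 2"
  obtains t where "0 \<le> t" "leaf_gf \<alpha> 1 t < 1"
proof -
  define r where "r n = 1 - 1 / real (Suc n)" for n
  have r: "0 \<le> r n" "r n < 1" for n by (auto simp: r_def)
  have r_mono: "r m \<le> r n" if "m \<le> n" for m n
    using that by (auto simp: r_def frac_le)
  have r_lim: "r \<longlonglongrightarrow> 1"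
    unfolding r_def using tendsto_diff[OF tendsto_const LIMSEQ_inverse_real_of_nat, of 1]
    by (simp add: inverse_eq_divide)
  have "\<exists>t. 0 \<le> t \<and> 2 - \<alpha> < 1 - leaf_gf \<alpha> (r n) t" for n
    using leaf_gf_deficit_large[OF \<alpha> r[of n]] by metis
  then obtain s where s: "\<And>n. 0 \<le> s n" "\<And>n. 2 - \<alpha> < 1 - leaf_gf \<alpha> (r n) (s n)"
    by metis
  obtain R where R: "\<And>t. R \<le> t \<Longrightarrow> 1 - (2 - \<alpha>) < leaf_gf \<alpha> 0 t"
    using leaf_gf_0_near_1[of \<alpha> "2 - \<alpha>"] \<alpha> by auto
  have "s n \<le> R" for n
  proof (rule ccontr)
    assume "\<not> s n \<le> R"
    then have "1 - (2 - \<alpha>) < leaf_gf \<alpha> 0 (s n)" using R by simp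
    also have "\<dots> \<le> leaf_gf \<alpha> (r n) (s n)"
      using r[of n] by (intro leaf_gf_mono) auto
    finally show False using s(2)[of n] by simp
  qed
  then have "\<forall>n. s n \<in> {0..R}" using s by simp
  then obtain \<tau> \<sigma> where \<tau>: "\<tau> \<in> {0..R}" and \<sigma>: "strict_mono \<sigma>" "(s \<circ> \<sigma>) \<longlonglongrightarrow> \<tau>"
    using seq_compactE[OF compact_imp_seq_compact[OF compact_Icc]] by metis
  have "leaf_gf \<alpha> (r m) \<tau> \<le> \<alpha> - 1" for m
  proof (rule tendsto_upperbound)
    have "continuous_on {0..} (leaf_gf \<alpha> (r m))"
      using \<alpha> r[of m] by (intro continuous_on_leaf_gf) auto
    from continuous_on_tendsto_compose[OF this \<sigma>(2)] \<tau> s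
    show "(\<lambda>n. leaf_gf \<alpha> (r m) ((s \<circ> \<sigma>) n)) \<longlonglongrightarrow> leaf_gf \<alpha> (r m) \<tau>" by auto
    show "\<forall>\<^sub>F n in sequentially. leaf_gf \<alpha> (r m) ((s \<circ> \<sigma>) n) \<le> \<alpha> - 1"
    proof (rule eventually_sequentiallyI[of m])
      fix n assume "m \<le> n"
      then have "m \<le> \<sigma> n" using seq_suble[OF \<sigma>(1), of n] by linarith
      then have "leaf_gf \<alpha> (r m) (s (\<sigma> n)) \<le> leaf_gf \<alpha> (r (\<sigma> n)) (s (\<sigma> n))"
        using r[of m] r[of "\<sigma> n"] by (intro leaf_gf_mono r_mono) auto
      then show "leaf_gf \<alpha> (r m) ((s \<circ> \<sigma>) n) \<le> \<alpha> - 1"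
        using s(2)[of "\<sigma> n"] by simp
    qed
  qed simp
  moreover have "(\<lambda>m. leaf_gf \<alpha> (r m) \<tau>) \<longlonglongrightarrow> leaf_gf \<alpha> 1 \<tau>"
    using r by (intro leaf_gf_tendsto r_lim) (auto intro: less_imp_le)
  ultimately have "leaf_gf \<alpha> 1 \<tau> \<le> \<alpha> - 1"
    by (intro tendsto_upperbound[of "\<lambda>m. leaf_gf \<alpha> (r m) \<tau>"]) auto
  then show ?thesis using that[of \<tau>] \<tau> \<alpha> by auto
qed

lemma leaf_gf_1_less_1:
  assumes "1 < \<alpha>" "\<alpha> < 2" "0 < t"
  shows "leaf_gf \<alpha> 1 t < 1"
proof (rule ccontr)
  assume "\<not> leaf_gf \<alpha> 1 t < 1"
  then have "leaf_gf \<alpha> 1 t = 1" using leaf_gf_le_1[of 1 \<alpha> t] by simp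
  then have "leaf_gf \<alpha> 1 x = 1" if "0 \<le> x" for x
    using leaf_gf_1_saturated assms that by blast
  then show False using leaf_gf_1_less_somewhere[of \<alpha>] assms by (metis less_irrefl)
qed

section \<open>Transfer to arbitrary families and the shortest path\<close>

text \<open>
  Independence identifies the joint law of the family with the product measure, so that all
  probabilities can be computed for the canonical cascade.
\<close>

lemma
  assumes M: "prob_space M" and T: "iid_exponential_family M T"
  shows measurable_cascade: "(\<lambda>\<omega> v. T v \<omega>) \<in> measurable M tree_law"
    and distr_cascade: "distr M tree_law (\<lambda>\<omega> v. T v \<omega>) = tree_law"
proof -
  interpret prob_space M by (rule M)
  have dist: "distributed M lborel (T v) (exponential_density 1)" for v
    using T by (simp add: iid_exponential_family_def)
  have rv: "T v \<in> borel_measurable M" for v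
    using distributed_measurable[OF dist[of v]] by simp
  have law: "distr M borel (T v) = exp_law" for v
  proof -
    have "distr M borel (T v) = distr M lborel (T v)" by (intro distr_cong) auto
    then show ?thesis using distributed_distr_eq_density[OF dist[of v]] by (simp add: exp_law_def)
  qed
  have "(\<lambda>\<omega> v. T v \<omega>) \<in> measurable M (PiM UNIV (\<lambda>_. borel))"
    by (rule measurable_PiM_single') (use rv in auto)
  then show "(\<lambda>\<omega> v. T v \<omega>) \<in> measurable M tree_law"
    unfolding measurable_cong_sets[OF refl sets_tree_law] .
  have "indep_vars (\<lambda>_. borel) T UNIV"
    using T by (simp add: iid_exponential_family_def)
  then have "distr M (PiM UNIV (\<lambda>_. borel)) (\<lambda>\<omega>. \<lambda>v\<in>UNIV. T v \<omega>) = PiM UNIV (\<lambda>v. distr M borel (T v))"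
    by (subst (asm) indep_vars_iff_distr_eq_PiM) (use rv in auto)
  then have "distr M (PiM UNIV (\<lambda>_. borel)) (\<lambda>\<omega> v. T v \<omega>) = tree_law"
    by (simp add: law tree_law_def restrict_def)
  moreover have "distr M tree_law (\<lambda>\<omega> v. T v \<omega>) = distr M (PiM UNIV (\<lambda>_. borel)) (\<lambda>\<omega> v. T v \<omega>)"
    by (intro distr_cong sets_tree_law) auto
  ultimately show "distr M tree_law (\<lambda>\<omega> v. T v \<omega>) = tree_law" by simp
qed

lemma t_leaves_eq_leaves: "t \<noteq> 0 \<Longrightarrow> t_leaves \<alpha> T t \<omega> = leaves \<alpha> (\<lambda>v. T v \<omega>) t"
  by (simp add: t_leaves_def leaves_def path_sum_def lessThan_Suc_atMost)

lemma prob_finite_leaves_eq_leaf_gf: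
  assumes M: "prob_space M" and T: "iid_exponential_family M T" and \<alpha>: "0 < \<alpha>"
  shows "prob_finite_leaves M \<alpha> T = leaf_gf \<alpha> 1"
proof
  fix t
  interpret prob_space M by (rule M)
  show "prob_finite_leaves M \<alpha> T t = leaf_gf \<alpha> 1 t"
  proof (cases "t = 0")
    case True
    then show ?thesis
      using \<alpha> by (simp add: prob_finite_leaves_def t_leaves_def leaf_gf_0 prob_space)
  next
    case False
    have "leaf_gf \<alpha> 1 t = measure (distr M tree_law (\<lambda>\<omega> v. T v \<omega>)) {x. finite (leaves \<alpha> x t)}"
      by (simp add: leaf_gf_at_1 distr_cascade[OF M T])
    also have "\<dots> = prob_finite_leaves M \<alpha> T t"
      using False by (subst measure_distr[OF measurable_cascade[OF M T] sets_finite_leaves])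
        (auto simp: prob_finite_leaves_def t_leaves_eq_leaves intro!: arg_cong[where f="measure M"])
    finally show ?thesis by simp
  qed
qed

text \<open>
  The limit defining the shortest path is a supremum, because the minimum over a level is
  nondecreasing in the level for nonnegative lifetimes; a supremum above \<open>t\<close> is witnessed by one
  level.
\<close>

lemma level_above_if_shortest_path_gt:
  assumes \<alpha>: "0 < \<alpha>" and nn: "\<And>v. 0 \<le> T v \<omega>" and S: "ereal t < shortest_path \<alpha> T \<omega>"
  obtains n where "\<And>v. length v = n \<Longrightarrow> t < path_sum \<alpha> (\<lambda>v. T v \<omega>) v (Suc n)"
proof -
  let ?x = "\<lambda>v. T v \<omega>"
  define m where "m n = (MIN v\<in>{v. length v = n}. path_sum \<alpha> ?x v (Suc n))" for n
  have fin: "finite {v :: vertex. length v = n}" for n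
    using finite_lists_length_eq[of "UNIV :: bool set" n] by simp
  have ne: "{v :: vertex. length v = n} \<noteq> {}" for n
    using length_replicate[of n True] by blast
  have m_le: "m n \<le> path_sum \<alpha> ?x v (Suc n)" if "length v = n" for v n
    unfolding m_def using fin that by (intro Min_le) auto
  have "incseq (\<lambda>n. ereal (m n))"
  proof (rule incseq_SucI)
    fix n
    have "m n \<le> path_sum \<alpha> ?x v (Suc (Suc n))" if "length v = Suc n" for v
    proof -
      have "m n \<le> path_sum \<alpha> ?x (take n v) (Suc n)" using that by (intro m_le) simp
      also have "\<dots> = path_sum \<alpha> ?x v (Suc n)" by (rule path_sum_take) simp
      also have "\<dots> \<le> path_sum \<alpha> ?x v (Suc (Suc n))" using \<alpha> nn by (intro path_sum_mono) auto
      finally show ?thesis .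
    qed
    then show "ereal (m n) \<le> ereal (m (Suc n))"
      unfolding m_def[of "Suc n"] using fin ne by (simp add: Min_ge_iff)
  qed
  then have "lim (\<lambda>n. ereal (m n)) = (SUP n. ereal (m n))"
    by (intro limI LIMSEQ_SUP)
  moreover have "shortest_path \<alpha> T \<omega> = lim (\<lambda>n. ereal (m n))"
    by (simp add: shortest_path_def m_def path_sum_def lessThan_Suc_atMost)
  ultimately obtain n where "t < m n"
    using S by (auto simp: less_SUP_iff)
  then show ?thesis using m_le by (intro that[of n]) (meson order_less_le_trans)
qed

lemma finite_leaves_if_level_above:
  assumes \<alpha>: "0 < \<alpha>" and x: "\<And>v. 0 \<le> x v"
    and n: "\<And>v. length v = n \<Longrightarrow> t < path_sum \<alpha> x v (Suc n)"
  shows "finite (leaves \<alpha> x t)"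
proof (rule finite_subset)
  show "leaves \<alpha> x t \<subseteq> {v. set v \<subseteq> UNIV \<and> length v \<le> n}"
  proof (rule subsetI, rule ccontr)
    fix v assume v: "v \<in> leaves \<alpha> x t" "v \<notin> {v. set v \<subseteq> UNIV \<and> length v \<le> n}"
    then have "t < path_sum \<alpha> x (take n v) (Suc n)" by (intro n) auto
    also have "\<dots> = path_sum \<alpha> x v (Suc n)" by (rule path_sum_take) simp
    also have "\<dots> \<le> path_sum \<alpha> x v (length v)" using \<alpha> x v by (intro path_sum_mono) auto
    finally show False using v by (simp add: leaves_def)
  qed
  show "finite {v :: vertex. set v \<subseteq> UNIV \<and> length v \<le> n}"
    by (rule finite_lists_length_le) simp
qed

lemma path_sum_le_if_no_leaves:
  assumes empty: "leaves \<alpha> x t = {}" and t: "0 \<le> t"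
  shows "path_sum \<alpha> x v (Suc (length v)) \<le> t"
proof (induction v rule: rev_induct)
  case Nil
  have "[] \<notin> leaves \<alpha> x t" using empty by simp
  then show ?case using t by (simp add: leaves_def path_sum_def not_less)
next
  case (snoc b v)
  have "path_sum \<alpha> x (v @ [b]) (length (v @ [b])) = path_sum \<alpha> x v (Suc (length v))"
    using path_sum_take[of "Suc (length v)" "length v" \<alpha> x "v @ [b]"] by simp
  moreover have "v @ [b] \<notin> leaves \<alpha> x t" using empty by simp
  ultimately show ?case using snoc by (simp add: leaves_def not_less)
qed

text \<open>
  If \<open>S > t\<close>, then the set of leaves is finite and nonempty. Hence the finiteness event contains,
  up to a null set, the disjoint union of \<open>[S > t]\<close> and the event that there are no leaves, and the
  latter has positive probability.
\<close>

lemma prob_shortest_path_gt_less: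
  assumes M: "prob_space M" and T: "iid_exponential_family M T" and \<alpha>: "1 < \<alpha>" and t: "0 < t"
  shows "prob_shortest_path_gt M \<alpha> T t < leaf_gf \<alpha> 1 t"
proof -
  interpret prob_space M by (rule M)
  let ?X = "\<lambda>\<omega> v. T v \<omega>"
  let ?F = "?X -` {x. finite (leaves \<alpha> x t)} \<inter> space M"
  let ?N = "?X -` {x. leaves \<alpha> x t = {}} \<inter> space M"
  note X = measurable_cascade[OF M T]
  have F: "?F \<in> sets M" and N: "?N \<in> sets M"
    by (rule measurable_sets[OF X], rule sets_finite_leaves sets_no_leaves)+
  have "AE x in distr M tree_law ?X. \<forall>v. 0 \<le> x v"
    unfolding distr_cascade[OF M T] by (rule AE_tree_law_nonneg)
  then have nn: "AE \<omega> in M. \<forall>v. 0 \<le> T v \<omega>"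
    by (rule AE_distrD[OF X])
  have "prob_shortest_path_gt M \<alpha> T t \<le> measure M (?F - ?N)"
    unfolding prob_shortest_path_gt_def
  proof (rule finite_measure_mono_AE)
    show "AE \<omega> in M. \<omega> \<in> {\<omega> \<in> space M. shortest_path \<alpha> T \<omega> > ereal t} \<longrightarrow> \<omega> \<in> ?F - ?N"
      using nn
    proof eventually_elim
      case (elim \<omega>)
      show ?case
      proof
        assume \<omega>: "\<omega> \<in> {\<omega> \<in> space M. shortest_path \<alpha> T \<omega> > ereal t}"
        then obtain n where n: "\<And>v. length v = n \<Longrightarrow> t < path_sum \<alpha> (?X \<omega>) v (Suc n)"
          using level_above_if_shortest_path_gt[of \<alpha> T \<omega> t] \<alpha> elim by auto
        have "finite (leaves \<alpha> (?X \<omega>) t)"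
          using \<alpha> elim n by (intro finite_leaves_if_level_above[of \<alpha> "?X \<omega>" n]) auto
        moreover have "leaves \<alpha> (?X \<omega>) t \<noteq> {}"
          using path_sum_le_if_no_leaves[of \<alpha> "?X \<omega>" t "replicate n True"] n[of "replicate n True"] t
          by auto
        ultimately show "\<omega> \<in> ?F - ?N" using \<omega> by simp
      qed
    qed
    show "?F - ?N \<in> sets M" using F N by simp
  qed
  also have "\<dots> = measure M ?F - measure M ?N"
    using F N by (intro finite_measure_Diff) auto
  also have "measure M ?F = leaf_gf \<alpha> 1 t"
    using measure_distr[OF X sets_finite_leaves] by (simp add: distr_cascade[OF M T] leaf_gf_at_1)
  also have "measure M ?N = leaf_gf \<alpha> 0 t"
    using measure_distr[OF X sets_no_leaves] by (simp add: distr_cascade[OF M T] leaf_gf_at_0)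
  finally show ?thesis using leaf_gf_0_pos[OF \<alpha> t] by linarith
qed

theorem mainTheorem2:
  fixes M :: "'a measure" and T :: "vertex \<Rightarrow> 'a \<Rightarrow> real" and \<alpha> :: real
  assumes "prob_space M"
    and "iid_exponential_family M T"
    and "1 < \<alpha>" and "\<alpha> < 2"
  shows "riccati_solution \<alpha> 1 (prob_finite_leaves M \<alpha> T) \<and>
    (\<exists>t\<ge>0. prob_finite_leaves M \<alpha> T t \<noteq> prob_shortest_path_gt M \<alpha> T t) \<and>
    (\<exists>t\<ge>0. prob_finite_leaves M \<alpha> T t \<noteq> 1) \<and>
    (\<forall>t>0. prob_shortest_path_gt M \<alpha> T t < prob_finite_leaves M \<alpha> T t \<and>
           prob_finite_leaves M \<alpha> T t < 1)"
proof -
  have \<alpha>: "0 < \<alpha>" using assms by simp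
  have v: "prob_finite_leaves M \<alpha> T = leaf_gf \<alpha> 1"
    by (rule prob_finite_leaves_eq_leaf_gf[OF assms(1,2) \<alpha>])
  have "leaf_gf \<alpha> 1 differentiable (at t) \<and> deriv (leaf_gf \<alpha> 1) t + leaf_gf \<alpha> 1 t = (leaf_gf \<alpha> 1 (\<alpha> * t))\<^sup>2"
    if "0 < t" for t
  proof -
    have D: "(leaf_gf \<alpha> 1 has_real_derivative (leaf_gf \<alpha> 1 (\<alpha> * t))\<^sup>2 - leaf_gf \<alpha> 1 t) (at t)"
      using leaf_gf_has_real_derivative[OF \<alpha>, of 1 t] that by simp
    then show ?thesis
      by (auto simp: DERIV_imp_deriv[OF D] real_differentiable_def)
  qed
  then have "riccati_solution \<alpha> 1 (leaf_gf \<alpha> 1)"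
    using \<alpha> by (simp add: riccati_solution_def continuous_on_leaf_gf leaf_gf_0)
  moreover have strict: "prob_shortest_path_gt M \<alpha> T t < leaf_gf \<alpha> 1 t \<and> leaf_gf \<alpha> 1 t < 1" if "0 < t" for t
    using prob_shortest_path_gt_less[OF assms(1-3) that] leaf_gf_1_less_1[OF assms(3,4) that] by simp
  moreover have "prob_shortest_path_gt M \<alpha> T 1 \<noteq> leaf_gf \<alpha> 1 1" "leaf_gf \<alpha> 1 1 \<noteq> 1"
    using strict[of 1] by linarith+
  ultimately show ?thesis
    unfolding v by (metis zero_le_one)
qed

end
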